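(* Let $\mathcal{R}$ be a ring with unity, let $b,c\in\mathcal{R}$ be regular, and let $a\in\mathcal{R}$, $g\in b\{1\}$ and $h\in c\{1\}$. The following statements are equivalent. (i) $a$ is $(b,c)$-invertible. (ii) $a$ is Bott-Duffin $(bg,hc)$-invertible. Furthermore, in this case $$a^{-(b,c)}=a^{-(bg,\,hc)}\quad\text{and}\quad \mathcal{R}^{-(b,c)}=\mathcal{R}^{-(bg,\,hc)}.$$
   Context: An element $x$ of a ring $\mathcal{R}$ with unity is regular if there is $w\in\mathcal{R}$ with $x=xwx$; $x\{1\}$ denotes the set of all such $w$ (inner inverses of $x$). Given $b,c\in\mathcal{R}$, an element $a\in\mathcal{R}$ is $(b,c)$-invertible if there is $y\in\mathcal{R}$ with $y\in(b\mathcal{R}y)\cap(y\mathcal{R}c)$, $b=yab$ and $c=cay$. Such a $y$ is unique if it exists; it is denoted $a^{-(b,c)}$, and $\mathcal{R}^{-(b,c)}=\{x\in\mathcal{R}: x^{-(b,c)}\text{ exists}\}$. Given idempotents $p,q\in\mathcal{R}$, an element $a\in\mathcal{R}$ is Bott-Duffin $(p,q)$-invertible if there is $y\in\mathcal{R}$ with $y=py=yq$, $yap=p$ and $qay=q$. This is the $(b,c)$-inverse for $b=p$, $c=q$; the element $y$ is unique if it exists and is denoted $a^{-(p,q)}$, and $\mathcal{R}^{-(p,q)}$ is the set of Bott-Duffin $(p,q)$-invertible elements. *)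

theory Defs
  imports Main
begin

text \<open>
  Rings with unity are types of sort \<open>{ring, monoid_mult}\<close>: associative rings with a
  multiplicative identity, not necessarily commutative. Unlike \<open>ring_1\<close>, this sort does not
  impose \<open>0 \<noteq> 1\<close>, so the zero ring is included.
\<close>

definition inner_inverses :: "'a::{ring, monoid_mult} \<Rightarrow> 'a set" where
  "inner_inverses x = {w. x = x * w * x}"

definition regular_element :: "'a::{ring, monoid_mult} \<Rightarrow> bool" where
  "regular_element x \<longleftrightarrow> (\<exists>w. x = x * w * x)"

definition is_bc_inverse :: "'a::{ring, monoid_mult} \<Rightarrow> 'a \<Rightarrow> 'a \<Rightarrow> 'a \<Rightarrow> bool" where
  "is_bc_inverse b c a y \<longleftrightarrow>
     y \<in> range (\<lambda>r. b * r * y) \<inter> range (\<lambda>r. y * r * c) \<and> b = y * a * b \<and> c = c * a * y"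

definition bc_invertible :: "'a::{ring, monoid_mult} \<Rightarrow> 'a \<Rightarrow> 'a \<Rightarrow> bool" where
  "bc_invertible b c a \<longleftrightarrow> (\<exists>y. is_bc_inverse b c a y)"

definition bc_inverse :: "'a::{ring, monoid_mult} \<Rightarrow> 'a \<Rightarrow> 'a \<Rightarrow> 'a" where
  "bc_inverse b c a = (THE y. is_bc_inverse b c a y)"

definition bc_invertibles :: "'a::{ring, monoid_mult} \<Rightarrow> 'a \<Rightarrow> 'a set" where
  "bc_invertibles b c = {x. bc_invertible b c x}"

text \<open>
  Bott-Duffin inverses are only defined relative to idempotents, so idempotence of \<open>p\<close>
  and \<open>q\<close> is made part of the predicate.
\<close>

definition is_bott_duffin_inverse :: "'a::{ring, monoid_mult} \<Rightarrow> 'a \<Rightarrow> 'a \<Rightarrow> 'a \<Rightarrow> bool" where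
  "is_bott_duffin_inverse p q a y \<longleftrightarrow>
     p * p = p \<and> q * q = q \<and>
     y = p * y \<and> y = y * q \<and> y * a * p = p \<and> q * a * y = q"

definition bott_duffin_invertible :: "'a::{ring, monoid_mult} \<Rightarrow> 'a \<Rightarrow> 'a \<Rightarrow> bool" where
  "bott_duffin_invertible p q a \<longleftrightarrow> (\<exists>y. is_bott_duffin_inverse p q a y)"

definition bott_duffin_inverse :: "'a::{ring, monoid_mult} \<Rightarrow> 'a \<Rightarrow> 'a \<Rightarrow> 'a" where
  "bott_duffin_inverse p q a = (THE y. is_bott_duffin_inverse p q a y)"

definition bott_duffin_invertibles :: "'a::{ring, monoid_mult} \<Rightarrow> 'a \<Rightarrow> 'a set" where
  "bott_duffin_invertibles p q = {x. bott_duffin_invertible p q x}"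

text \<open>Uniqueness, which justifies the definite descriptions above.\<close>

lemma is_bc_inverse_unique:
  assumes "is_bc_inverse b c a y" and "is_bc_inverse b c a z"
  shows "y = z"
proof -
  obtain r where y: "y = b * r * y" and zb: "b = z * a * b"
    using assms unfolding is_bc_inverse_def by blast
  obtain s where z: "z = z * s * c" and cy: "c = c * a * y"
    using assms unfolding is_bc_inverse_def by blast
  have "y = z * a * y" using y zb by (metis mult.assoc)
  also have "\<dots> = z" using z cy by (metis mult.assoc)
  finally show ?thesis .
qed

lemma is_bott_duffin_inverse_unique:
  assumes "is_bott_duffin_inverse p q a y" and "is_bott_duffin_inverse p q a z"
  shows "y = z"
proof -
  have "y = z * a * y"
    using assms unfolding is_bott_duffin_inverse_def by (metis mult.assoc)
  also have "\<dots> = z"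
    using assms unfolding is_bott_duffin_inverse_def by (metis mult.assoc)
  finally show ?thesis .
qed

lemma bc_inverse_eqI: "is_bc_inverse b c a y \<Longrightarrow> bc_inverse b c a = y"
  unfolding bc_inverse_def by (blast intro: is_bc_inverse_unique)

lemma bott_duffin_inverse_eqI:
  "is_bott_duffin_inverse p q a y \<Longrightarrow> bott_duffin_inverse p q a = y"
  unfolding bott_duffin_inverse_def by (blast intro: is_bott_duffin_inverse_unique)

end

theory Submission
  imports Defs
begin

text \<open>Because \<open>b * g * b = b\<close> and \<open>c * h * c = c\<close>, the elements
  \<open>b * g\<close> and \<open>h * c\<close> are idempotents with the same right ideal as
  \<open>b\<close> and the same left ideal as \<open>c\<close>, respectively. The conditions on
  \<open>y\<close> say that \<open>y\<close> lies in these ideals and that \<open>y * a\<close> and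
  \<open>a * y\<close> act on them as left and right identity, so they do not distinguish
  \<open>b\<close> from \<open>b * g\<close> or \<open>c\<close> from \<open>h * c\<close>. Hence
  both predicates have exactly the same witnesses \<open>y\<close>.\<close>

lemma is_bc_inverse_iff_is_bott_duffin_inverse:
  fixes a b c g h y :: "'a::{ring, monoid_mult}"
  assumes "g \<in> inner_inverses b" and "h \<in> inner_inverses c"
  shows "is_bc_inverse b c a y \<longleftrightarrow> is_bott_duffin_inverse (b * g) (h * c) a y"
proof
  have b: "b * g * b = b" and c: "c * h * c = c"
    using assms by (simp_all add: inner_inverses_def)
  show "is_bott_duffin_inverse (b * g) (h * c) a y" if "is_bc_inverse b c a y"
  proof -
    from that obtain r s where r: "y = b * r * y" and s: "y = y * s * c"
      and yab: "y * a * b = b" and cay: "c * a * y = c"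
      unfolding is_bc_inverse_def by auto
    \<comment> \<open>Left multiplication by \<open>b * g\<close> fixes every element that starts
      with \<open>b\<close>; dually, right multiplication by \<open>h * c\<close> fixes every
      element that ends in \<open>c\<close>.\<close>
    have "b * g * y = b * g * b * r * y"
      using r by (metis mult.assoc)
    then have "y = b * g * y" using r b by simp
    moreover have "y * (h * c) = y * s * (c * h * c)"
      using s by (metis mult.assoc)
    then have "y = y * (h * c)" using s c by simp
    moreover have "b * g * (b * g) = b * g" using b by (metis mult.assoc)
    moreover have "h * c * (h * c) = h * c" using c by (metis mult.assoc)
    moreover have "y * a * (b * g) = b * g" using yab by (metis mult.assoc)
    moreover have "h * c * a * y = h * c" using cay by (metis mult.assoc)
    ultimately show ?thesis unfolding is_bott_duffin_inverse_def by blast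
  qed
  show "is_bc_inverse b c a y" if "is_bott_duffin_inverse (b * g) (h * c) a y"
  proof -
    from that have y: "y = b * g * y" "y = y * h * c"
      and yabg: "y * a * (b * g) = b * g" and hcay: "h * c * a * y = h * c"
      unfolding is_bott_duffin_inverse_def by (auto simp: mult.assoc)
    \<comment> \<open>Multiply \<open>yabg\<close> on the right by \<open>b\<close> and collapse
      \<open>b * g * b\<close>; the next step multiplies \<open>hcay\<close> on the left by
      \<open>c\<close>.\<close>
    have "y * a * b = b" using b yabg by (metis mult.assoc)
    moreover have "c * a * y = c" using c hcay by (metis mult.assoc)
    \<comment> \<open>The memberships in the two ranges are witnessed by \<open>g\<close> and
      \<open>h\<close>.\<close>
    ultimately show ?thesis
      using y unfolding is_bc_inverse_def by auto
  qed
qed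

theorem proposition5p1:
  fixes a b c g h :: "'a::{ring, monoid_mult}"
  assumes "regular_element b" and "regular_element c"
    and "g \<in> inner_inverses b" and "h \<in> inner_inverses c"
  shows "(bc_invertible b c a \<longleftrightarrow> bott_duffin_invertible (b * g) (h * c) a) \<and>
    (bc_invertible b c a \<longrightarrow>
       bc_inverse b c a = bott_duffin_inverse (b * g) (h * c) a \<and>
       bc_invertibles b c = bott_duffin_invertibles (b * g) (h * c))"
  \<comment> \<open>The equivalence holds for all \<open>a\<close> and \<open>y\<close>, so the
    existence statements, the definite descriptions and the sets of invertible elements coincide on
    unfolding.\<close>
  using is_bc_inverse_iff_is_bott_duffin_inverse[OF assms(3,4)]
  by (simp add: bc_invertible_def bott_duffin_invertible_def bc_inverse_def
      bott_duffin_inverse_def bc_invertibles_def bott_duffin_invertibles_def)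

end
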